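(* Let $K$ be a field, let $G$ be a finite simple graph on $n$ vertices $x_1,\ldots,x_n$ which is not the complete graph $K_n$, and let $k=\kappa(G)$ be its vertex connectivity. Let $S=K[x_1,\ldots,x_n]$ and let $I(G^c)\subset S$ be the edge ideal of the complementary graph $G^c$ of $G$. Then $$\operatorname{depth}\, S/I(G^c)\;\geq\;\left\lceil\frac{k}{2(n-k-1)}\right\rceil+1.$$
   Context: All graphs are finite and simple. For a graph $G$ with vertex set $V(G)$ and $W\subset V(G)$, $G-W$ denotes the induced subgraph of $G$ on $V(G)\setminus W$. If $G$ is not a complete graph, the vertex connectivity $\kappa(G)$ is the smallest cardinality of a subset $W\subset V(G)$ for which $G-W$ is disconnected (so $\kappa(G)=0$ if and only if $G$ is disconnected). The complementary graph $G^c$ has the same vertex set as $G$, and two distinct vertices are adjacent in $G^c$ if and only if they are not adjacent in $G$. For a graph $H$ on the vertex set $\{x_1,\ldots,x_n\}$, the edge ideal of $H$ is $I(H)=(x_ix_j : 1\leq i<j\leq n,\ \{x_i,x_j\}\in E(H))\subset S=K[x_1,\ldots,x_n]$, where vertices are identified with variables. Depth is taken with respect to the graded maximal ideal $(x_1,\ldots,x_n)$ of $S$. *)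

theory Defs
  imports
    Complex_Main
    "HOL-Library.Poly_Mapping"
    "HOL-Library.Extended_Nat"
    "Graph_Theory.Graph_Theory"
begin

section \<open>Graphs\<close>

text \<open>
  A finite simple graph is a \<open>pair_graph\<close>: a finite vertex set with a symmetric, irreflexive
  set of arcs, so the edge between \<open>u\<close> and \<open>v\<close> is represented by both \<open>(u, v)\<close> and \<open>(v, u)\<close>.
\<close>

definition complement_graph :: "'v pair_pre_digraph \<Rightarrow> 'v pair_pre_digraph" where
  "complement_graph G =
    \<lparr> pverts = pverts G,
      parcs = {(u, v). u \<in> pverts G \<and> v \<in> pverts G \<and> u \<noteq> v \<and> (u, v) \<notin> parcs G} \<rparr>"

text \<open>
  Meaningful for non-complete graphs only. The library regards the graph without vertices as not
  connected, so \<open>W = pverts G\<close> is admitted below; for a non-complete graph this does not affect the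
  minimum, because removing all vertices but two non-adjacent ones disconnects the graph.
\<close>

definition vertex_connectivity :: "'v pair_pre_digraph \<Rightarrow> nat" where
  "vertex_connectivity G =
    (LEAST c. \<exists>W \<subseteq> pverts G. card W = c \<and>
       \<not> Digraph_Component.connected (with_proj G \<restriction> (pverts G - W)))"


section \<open>Ideals and depth\<close>

definition ideal_gen :: "'a::comm_ring_1 set \<Rightarrow> 'a set" where
  "ideal_gen B = module.span (*) B"

text \<open>
  \<open>regular_on_quotient I [f\<^sub>1, \<dots>, f\<^sub>r]\<close>: the sequence is \<open>M\<close>-regular for the module \<open>M = R/I\<close>, that is,
  every \<open>f\<^sub>i\<close> is a nonzerodivisor on \<open>M/(f\<^sub>1, \<dots>, f\<^sub>i\<^sub>-\<^sub>1)M\<close> and \<open>M/(f\<^sub>1, \<dots>, f\<^sub>r)M\<close> is nonzero. Here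
  \<open>M/(f\<^sub>1, \<dots>, f\<^sub>i)M\<close> is \<open>R/(I + (f\<^sub>1, \<dots>, f\<^sub>i))\<close>, and its elements are written through representatives.
\<close>

definition regular_on_quotient :: "'a::comm_ring_1 set \<Rightarrow> 'a list \<Rightarrow> bool" where
  "regular_on_quotient I fs \<longleftrightarrow>
    (\<forall>i < length fs. \<forall>g.
       fs ! i * g \<in> ideal_gen (I \<union> set (take i fs)) \<longrightarrow> g \<in> ideal_gen (I \<union> set (take i fs))) \<and>
    ideal_gen (I \<union> set fs) \<noteq> UNIV"

text \<open>
  The depth of \<open>R/I\<close> with respect to the ideal \<open>\<mm>\<close>. It is valued in \<open>enat\<close> so that no finiteness of
  the supremum is presupposed.
\<close>

definition depth_quotient :: "'a::comm_ring_1 set \<Rightarrow> 'a set \<Rightarrow> enat" where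
  "depth_quotient \<mm> I = (SUP fs \<in> {fs. set fs \<subseteq> \<mm> \<and> regular_on_quotient I fs}. enat (length fs))"


section \<open>Polynomial rings and edge ideals\<close>

text \<open>
  Monomials are finitely supported exponent vectors, so for a finite type \<open>'v\<close> this is the
  polynomial ring over \<open>'k\<close> whose variables are exactly the elements of \<open>'v\<close>.
\<close>

type_synonym ('v, 'k) polynomial_ring = "('v \<Rightarrow>\<^sub>0 nat) \<Rightarrow>\<^sub>0 'k"

definition variable :: "'v \<Rightarrow> ('v, 'k::field) polynomial_ring" where
  "variable v = Poly_Mapping.single (Poly_Mapping.single v 1) 1"

definition graded_maximal_ideal :: "('v, 'k::field) polynomial_ring set" where
  "graded_maximal_ideal = ideal_gen (range variable)"

definition edge_ideal :: "'v pair_pre_digraph \<Rightarrow> ('v, 'k::field) polynomial_ring set" where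
  "edge_ideal H = ideal_gen {variable u * variable v | u v. (u, v) \<in> parcs H}"

end

theory Submission
  imports Defs
begin

text \<open>
  Modulo \<open>I(G\<^sup>c)\<close> the polynomial ring becomes the face ring of the clique complex of \<open>G\<close>. For a vertex
  \<open>w\<close> of a complex, the colon ideal by \<open>x\<^sub>w\<close> belongs to the star of \<open>w\<close> and adding \<open>x\<^sub>w\<close> belongs to the
  deletion of \<open>w\<close>; a sequence that is regular on both of these face rings is regular on the original
  one. The elementary symmetric polynomials \<open>e\<^sub>1, \<dots>, e\<^sub>r\<close> are regular on every polynomial ring in at least
  \<open>r\<close> of the variables, so it is enough to decompose the clique complex by stars and deletions into
  simplices with at least \<open>r\<close> vertices. This replaces the homological depth lemma. A connected graph can be
  decomposed with \<open>r = 2\<close> by adding one vertex at a time. In general every vertex has at most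
  \<open>d = n - k - 1\<close> non-neighbours, and one further variable can be gained at the cost of deleting at most
  \<open>2d\<close> vertices, which lowers the connectivity by at most \<open>2d\<close>.
\<close>

abbreviation "lookup \<equiv> Poly_Mapping.lookup"
abbreviation "keys \<equiv> Poly_Mapping.keys"

section \<open>Regular sequences modulo an ideal\<close>

lemma module_mult: "module ((*) :: 'a::comm_ring_1 \<Rightarrow> 'a \<Rightarrow> 'a)"
  by unfold_locales (simp_all add: algebra_simps)

lemmas ideal_gen_add = module.span_add [OF module_mult, folded ideal_gen_def]
lemmas ideal_gen_diff = module.span_diff [OF module_mult, folded ideal_gen_def]
lemmas ideal_gen_mult = module.span_scale [OF module_mult, folded ideal_gen_def]
lemmas ideal_gen_base = module.span_base [OF module_mult, folded ideal_gen_def]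
lemmas ideal_gen_zero = module.span_zero [OF module_mult, folded ideal_gen_def]
lemmas ideal_gen_sum = module.span_sum [OF module_mult, folded ideal_gen_def]
lemmas ideal_gen_mono = module.span_mono [OF module_mult, folded ideal_gen_def]
lemmas ideal_gen_minimal = module.span_minimal [OF module_mult, folded ideal_gen_def]
lemmas ideal_gen_insert_iff = module.span_breakdown_eq [OF module_mult, folded ideal_gen_def]
lemmas ideal_gen_eq_iff = module.span_eq [OF module_mult, folded ideal_gen_def]

lemma ideal_gen_mult_right: "a \<in> ideal_gen B \<Longrightarrow> a * c \<in> ideal_gen B"
  using ideal_gen_mult [of a B c] by (simp add: mult.commute)

lemma ideal_gen_insertI: "p \<in> ideal_gen B \<Longrightarrow> p \<in> ideal_gen (insert f B)"
  using ideal_gen_mono [of B "insert f B"] by auto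

lemma ideal_gen_insertE:
  assumes "p \<in> ideal_gen (insert f B)"
  obtains a b where "b \<in> ideal_gen B" "p = b + a * f"
  using assms unfolding ideal_gen_insert_iff
  by (metis diff_add_cancel)

lemma ideal_gen_cong_Un:
  assumes "ideal_gen B = ideal_gen C"
  shows "ideal_gen (B \<union> S) = ideal_gen (C \<union> S)"
  using assms unfolding ideal_gen_eq_iff
  by (meson Un_least Un_upper1 Un_upper2 ideal_gen_base ideal_gen_mono subset_iff)

definition nonzerodivisor_mod :: "'a::comm_ring_1 set \<Rightarrow> 'a \<Rightarrow> bool" where
  "nonzerodivisor_mod B f \<longleftrightarrow> (\<forall>g. f * g \<in> ideal_gen B \<longrightarrow> g \<in> ideal_gen B)"

lemma nonzerodivisor_modI:
  "(\<And>g. f * g \<in> ideal_gen B \<Longrightarrow> g \<in> ideal_gen B) \<Longrightarrow> nonzerodivisor_mod B f"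
  unfolding nonzerodivisor_mod_def by blast

lemma nonzerodivisor_modD:
  "nonzerodivisor_mod B f \<Longrightarrow> f * g \<in> ideal_gen B \<Longrightarrow> g \<in> ideal_gen B"
  unfolding nonzerodivisor_mod_def by (elim allE impE)

text \<open>The requirement that the final quotient be nonzero is split off. It does not take part
  in the exact sequence arguments and is checked once, in \<open>depth_quotient_ge\<close>.\<close>

definition regular_mod :: "'a::comm_ring_1 set \<Rightarrow> 'a list \<Rightarrow> bool" where
  "regular_mod B fs \<longleftrightarrow> (\<forall>i < length fs. nonzerodivisor_mod (B \<union> set (take i fs)) (fs ! i))"

lemma regular_on_quotient_iff:
  "regular_on_quotient B fs \<longleftrightarrow> regular_mod B fs \<and> ideal_gen (B \<union> set fs) \<noteq> UNIV"
  by (simp add: regular_on_quotient_def regular_mod_def nonzerodivisor_mod_def)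

lemma regular_mod_Nil [simp]: "regular_mod B []"
  by (simp add: regular_mod_def)

lemma regular_mod_Cons [simp]:
  "regular_mod B (f # fs) \<longleftrightarrow> nonzerodivisor_mod B f \<and> regular_mod (insert f B) fs"
  by (simp add: regular_mod_def All_less_Suc2)

lemma regular_mod_append [simp]:
  "regular_mod B (fs @ gs) \<longleftrightarrow> regular_mod B fs \<and> regular_mod (B \<union> set fs) gs"
  by (induction fs arbitrary: B) auto

lemma regular_mod_cong:
  "ideal_gen B = ideal_gen C \<Longrightarrow> regular_mod B fs \<longleftrightarrow> regular_mod C fs"
  using ideal_gen_cong_Un [of B C] by (simp add: regular_mod_def nonzerodivisor_mod_def)

lemma nonzerodivisor_mod_mult:
  "nonzerodivisor_mod B f \<Longrightarrow> nonzerodivisor_mod B g \<Longrightarrow> nonzerodivisor_mod B (f * g)"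
  by (rule nonzerodivisor_modI) (metis mult.assoc nonzerodivisor_modD)

lemma nonzerodivisor_mod_one: "nonzerodivisor_mod B 1"
  by (simp add: nonzerodivisor_mod_def)

lemma nonzerodivisor_mod_prod:
  assumes "\<And>a. a \<in> A \<Longrightarrow> nonzerodivisor_mod B (f a)"
  shows "nonzerodivisor_mod B (\<Prod>a\<in>A. f a)"
  using assms
  by (induction A rule: infinite_finite_induct) (auto intro: nonzerodivisor_mod_mult nonzerodivisor_mod_one)

lemma nonzerodivisor_mod_congruent:
  assumes "f - f' \<in> ideal_gen B" "nonzerodivisor_mod B f'"
  shows "nonzerodivisor_mod B f"
proof (rule nonzerodivisor_modI)
  fix g assume "f * g \<in> ideal_gen B"
  moreover have "(f - f') * g \<in> ideal_gen B"
    using assms(1) by (rule ideal_gen_mult_right)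
  ultimately have "f * g - (f - f') * g \<in> ideal_gen B"
    by (rule ideal_gen_diff)
  then have "f' * g \<in> ideal_gen B" by (simp add: algebra_simps)
  with assms(2) show "g \<in> ideal_gen B" by (rule nonzerodivisor_modD)
qed

text \<open>
  The hypothesis on \<open>C\<close> says that it generates the colon ideal \<open>B : x\<close>, so that \<open>R/C\<close>, \<open>R/B\<close> and
  \<open>R/(B + x)\<close> form a short exact sequence; dividing out a nonzerodivisor on both ends keeps it exact.
\<close>

lemma regular_mod_colon:
  assumes "\<And>h. x * h \<in> ideal_gen B \<longleftrightarrow> h \<in> ideal_gen C"
    and "regular_mod C fs" "regular_mod (insert x B) fs"
  shows "regular_mod B fs"
  using assms
proof (induction fs arbitrary: B C)
  case (Cons f fs)
  have fC: "nonzerodivisor_mod C f" and fx: "nonzerodivisor_mod (insert x B) f"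
    using Cons.prems by auto
  have step: "\<exists>a h. a \<in> ideal_gen B \<and> g = a + h * x"
    if "f * g \<in> ideal_gen (insert x B)" for g
    by (rule ideal_gen_insertE [OF nonzerodivisor_modD [OF fx that]]) blast
  have "nonzerodivisor_mod B f"
    proof (rule nonzerodivisor_modI)
    fix g assume g: "f * g \<in> ideal_gen B"
    then obtain a h where a: "a \<in> ideal_gen B" "g = a + h * x"
      using step [OF ideal_gen_insertI] by blast
    have "f * g - f * a \<in> ideal_gen B"
      using ideal_gen_diff [OF g ideal_gen_mult [OF a(1)]] .
    moreover have "f * g - f * a = x * (f * h)" by (simp add: a(2) algebra_simps)
    ultimately have "x * (f * h) \<in> ideal_gen B" by simp
    then have "f * h \<in> ideal_gen C" by (simp only: Cons.prems(1))
    then have "h \<in> ideal_gen C" by (rule nonzerodivisor_modD [OF fC])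
    then have "x * h \<in> ideal_gen B" by (simp only: Cons.prems(1))
    then show "g \<in> ideal_gen B" by (simp add: a mult.commute ideal_gen_add)
  qed
  \<comment> \<open>The colon relation survives adding \<open>f\<close> to both ideals, so the
    induction continues with \<open>insert f B\<close> and \<open>insert f C\<close>.\<close>
  moreover have "regular_mod (insert f B) fs"
  proof (rule Cons.IH)
    fix h
    show "x * h \<in> ideal_gen (insert f B) \<longleftrightarrow> h \<in> ideal_gen (insert f C)"
    proof
      assume "x * h \<in> ideal_gen (insert f B)"
      then obtain b g where b: "b \<in> ideal_gen B" "x * h = b + g * f"
        by (rule ideal_gen_insertE)
      have "f * g = x * h - b" using b(2) by (simp add: mult.commute)
      \<comment> \<open>Modulo \<open>x\<close> the relation says that \<open>f\<close> kills
        \<open>g\<close>, so \<open>g\<close> is a multiple of \<open>x\<close> modulo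
        \<open>B\<close>; then \<open>x\<close> can be factored out of
        \<open>x * h - g * f\<close>.\<close>
      then have "f * g \<in> ideal_gen (insert x B)"
        by (simp add: b(1) ideal_gen_diff ideal_gen_base ideal_gen_mult_right ideal_gen_insertI)
      then obtain a h' where a: "a \<in> ideal_gen B" "g = a + h' * x" using step by blast
      have "x * (h - h' * f) = x * h - h' * x * f" by (simp add: algebra_simps)
      also have "\<dots> = b + f * a" using b(2) a(2) by (simp add: algebra_simps)
      finally have "x * (h - h' * f) = b + f * a" .
      then have "x * (h - h' * f) \<in> ideal_gen B"
        by (simp add: a(1) b(1) ideal_gen_add ideal_gen_mult)
      then show "h \<in> ideal_gen (insert f C)"
        unfolding Cons.prems(1) ideal_gen_insert_iff by blast
    next
      assume "h \<in> ideal_gen (insert f C)"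
      then obtain c g where c: "c \<in> ideal_gen C" "h = c + g * f"
        by (rule ideal_gen_insertE)
      have "x * h - x * g * f = x * c" by (simp add: c(2) algebra_simps)
      moreover have "x * c \<in> ideal_gen B" using c(1) by (simp only: Cons.prems(1))
      ultimately show "x * h \<in> ideal_gen (insert f B)"
        unfolding ideal_gen_insert_iff by metis
    qed
  next
    show "regular_mod (insert f C) fs" "regular_mod (insert x (insert f B)) fs"
      using Cons.prems by (auto simp: insert_commute)
  qed
  ultimately show ?case by simp
qed simp


section \<open>The grading of the polynomial ring\<close>

definition total_degree :: "('v::finite \<Rightarrow>\<^sub>0 nat) \<Rightarrow> nat" where
  "total_degree t = (\<Sum>v\<in>UNIV. lookup t v)"

lemma total_degree_add: "total_degree (s + t) = total_degree s + total_degree t"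
  by (simp add: total_degree_def lookup_add sum.distrib)

definition homogeneous :: "nat \<Rightarrow> ('v::finite, 'k::field) polynomial_ring \<Rightarrow> bool" where
  "homogeneous d p \<longleftrightarrow> (\<forall>t \<in> keys p. total_degree t = d)"

lift_definition homogeneous_component ::
    "nat \<Rightarrow> ('v::finite, 'k::field) polynomial_ring \<Rightarrow> ('v, 'k) polynomial_ring"
  is "\<lambda>d p t. if total_degree t = d then p t else 0"
  by (rule finite_subset) auto

lemma homogeneous_component_add:
  "homogeneous_component d (p + q) = homogeneous_component d p + homogeneous_component d q"
  by (rule poly_mapping_eqI) (simp add: homogeneous_component.rep_eq lookup_add)

lemma keys_homogeneous_component:
  "keys (homogeneous_component d p) = {t \<in> keys p. total_degree t = d}"
  by (auto simp: in_keys_iff homogeneous_component.rep_eq split: if_splits)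

lemma homogeneous_homogeneous_component [simp]: "homogeneous d (homogeneous_component d p)"
  by (simp add: homogeneous_def keys_homogeneous_component)

lemma homogeneous_component_same: "homogeneous d p \<Longrightarrow> homogeneous_component d p = p"
  by (rule poly_mapping_eqI)
    (auto simp: homogeneous_component.rep_eq homogeneous_def in_keys_iff)

lemma homogeneous_component_eq_0_iff:
  "homogeneous_component d p = 0 \<longleftrightarrow> (\<forall>t \<in> keys p. total_degree t \<noteq> d)"
  unfolding keys_eq_empty [symmetric] keys_homogeneous_component by blast

lemma sum_homogeneous_components:
  "(\<Sum>d \<in> total_degree ` keys p. homogeneous_component d p) = p"
proof (rule poly_mapping_eqI)
  fix t
  show "lookup (\<Sum>d \<in> total_degree ` keys p. homogeneous_component d p) t = lookup p t"
    by (auto simp: lookup_sum homogeneous_component.rep_eq in_keys_iff)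
qed

text \<open>Split \<open>p\<close> into its component of degree \<open>d\<close> and the rest
  \<open>q\<close>: all terms of \<open>f * q\<close> have degree different from
  \<open>e + d\<close>.\<close>

lemma homogeneous_component_mult:
  assumes "homogeneous e f"
  shows "homogeneous_component (e + d) (f * p) = f * homogeneous_component d p"
proof -
  define q where "q = p - homogeneous_component d p"
  have "homogeneous_component (e + d) (f * q) = 0"
    unfolding homogeneous_component_eq_0_iff
  proof
    fix t assume "t \<in> keys (f * q)"
    then obtain a b where t: "t = a + b" "a \<in> keys f" "b \<in> keys q"
      using keys_mult by blast
    have "total_degree b \<noteq> d"
      using t(3) by (auto simp: q_def in_keys_iff lookup_minus homogeneous_component.rep_eq)
    then show "total_degree t \<noteq> e + d"
      using assms t by (simp add: total_degree_add homogeneous_def)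
  qed
  moreover have "homogeneous (e + d) (f * homogeneous_component d p)"
    unfolding homogeneous_def
  proof
    fix t assume "t \<in> keys (f * homogeneous_component d p)"
    then obtain a b where "t = a + b" "a \<in> keys f" "b \<in> keys (homogeneous_component d p)"
      using keys_mult by blast
    then show "total_degree t = e + d"
      using assms by (simp add: total_degree_add homogeneous_def keys_homogeneous_component)
  qed
  moreover have "f * p = f * q + f * homogeneous_component d p"
    by (simp add: q_def algebra_simps)
  ultimately show ?thesis
    by (simp add: homogeneous_component_add homogeneous_component_same)
qed

lemma homogeneous_component_mult_small:
  assumes "homogeneous e f" "d < e"
  shows "homogeneous_component d (f * p) = 0"
  unfolding homogeneous_component_eq_0_iff
proof
  fix t assume "t \<in> keys (f * p)"
  then obtain a b where "t = a + b" "a \<in> keys f"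
    using keys_mult by blast
  then show "total_degree t \<noteq> d"
    using assms by (auto simp: total_degree_add homogeneous_def)
qed

lemma homogeneous_mult:
  assumes "homogeneous d p" "homogeneous e q"
  shows "homogeneous (d + e) (p * q)"
  using homogeneous_component_mult [OF assms(1), of e q] assms(2)
    homogeneous_homogeneous_component [of "d + e" "p * q"]
  by (simp add: homogeneous_component_same)

lemma homogeneous_variable: "homogeneous 1 (variable v)"
  by (simp add: homogeneous_def variable_def total_degree_def lookup_single when_def)

lemma homogeneous_prod_variables: "homogeneous (card F) (\<Prod>v\<in>F. variable v)"
proof (induction F rule: infinite_finite_induct)
  case (insert v F)
  then show ?case using homogeneous_mult [OF homogeneous_variable] by fastforce
qed (auto simp: homogeneous_def total_degree_def)

lemma homogeneous_sum: "(\<And>a. a \<in> A \<Longrightarrow> homogeneous d (f a)) \<Longrightarrow> homogeneous d (sum f A)"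
proof (induction A rule: infinite_finite_induct)
  case (insert a A)
  then show ?case using keys_add [of "f a" "sum f A"] by (auto simp: homogeneous_def)
qed (auto simp: homogeneous_def)

section \<open>Homogeneous ideals and permutation of regular sequences\<close>

definition homogeneous_ideal :: "('v::finite, 'k::field) polynomial_ring set \<Rightarrow> bool" where
  "homogeneous_ideal B \<longleftrightarrow> (\<forall>p \<in> ideal_gen B. \<forall>d. homogeneous_component d p \<in> ideal_gen B)"

lemma homogeneous_ideal_insert:
  assumes "homogeneous_ideal B" "homogeneous e f"
  shows "homogeneous_ideal (insert f B)"
  unfolding homogeneous_ideal_def
proof (intro ballI allI)
  fix p d assume "p \<in> ideal_gen (insert f B)"
  then obtain b a where b: "b \<in> ideal_gen B" "p = b + a * f"
    by (rule ideal_gen_insertE)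
  have "homogeneous_component d (f * a) \<in> ideal_gen (insert f B)"
  proof (cases "d < e")
    case True
    then show ?thesis using assms(2) by (simp add: homogeneous_component_mult_small ideal_gen_zero)
  next
    case False
    then have "homogeneous_component d (f * a) = f * homogeneous_component (d - e) a"
      using homogeneous_component_mult [OF assms(2), of "d - e" a] by simp
    then show ?thesis by (simp add: ideal_gen_base ideal_gen_mult_right)
  qed
  moreover have "homogeneous_component d b \<in> ideal_gen (insert f B)"
    using assms(1) b(1) by (auto simp: homogeneous_ideal_def intro: ideal_gen_insertI)
  ultimately show "homogeneous_component d p \<in> ideal_gen (insert f B)"
    using b(2) by (simp add: homogeneous_component_add ideal_gen_add mult.commute)
qed

text \<open>
  Only here is the grading used: it replaces Nakayama's lemma (or Krull's intersection theorem), since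
  dividing a homogeneous element by a variable lowers its degree.
\<close>

lemma nonzerodivisor_mod_lift_variable:
  fixes f :: "('v::finite, 'k::field) polynomial_ring"
  assumes "homogeneous_ideal B" "homogeneous e f"
    and "nonzerodivisor_mod B (variable y)" "nonzerodivisor_mod (insert (variable y) B) f"
  shows "nonzerodivisor_mod B f"
proof -
  have hom: "g \<in> ideal_gen B" if "homogeneous d g" "f * g \<in> ideal_gen B" for d g
    using that
  proof (induction d arbitrary: g rule: less_induct)
    case (less d)
    have "g \<in> ideal_gen (insert (variable y) B)"
      using nonzerodivisor_modD [OF assms(4) ideal_gen_insertI [OF less.prems(2)]] .
    then obtain b a where b: "b \<in> ideal_gen B" "g = b + a * variable y"
      by (rule ideal_gen_insertE)
    define b' where "b' = homogeneous_component d b"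
    have b': "b' \<in> ideal_gen B"
      using assms(1) b(1) by (simp add: b'_def homogeneous_ideal_def)
    have g: "g = b' + homogeneous_component d (variable y * a)"
      using homogeneous_component_same [OF less.prems(1)] b(2)
      by (simp add: b'_def homogeneous_component_add mult.commute)
    show ?case
    proof (cases d)
      \<comment> \<open>In degree 0 no multiple of a variable survives, so \<open>g\<close> equals
        \<open>b'\<close>. In positive degree the variable cancels and leaves \<open>a'\<close> of
        degree one less.\<close>
      case 0
      have "homogeneous_component d (variable y * a) = 0"
        by (rule homogeneous_component_mult_small [OF homogeneous_variable]) (simp add: 0)
      then show ?thesis using g b' by simp
    next
      case (Suc d')
      define a' where "a' = homogeneous_component d' a"
      have g': "g = b' + variable y * a'"
        using g homogeneous_component_mult [OF homogeneous_variable, of d' y a] Suc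
        by (simp add: a'_def)
      have "f * g - f * b' \<in> ideal_gen B"
        using ideal_gen_diff [OF less.prems(2) ideal_gen_mult [OF b']] .
      then have "variable y * (f * a') \<in> ideal_gen B"
        using g' by (simp add: algebra_simps)
      then have "f * a' \<in> ideal_gen B"
        by (rule nonzerodivisor_modD [OF assms(3)])
      then have "a' \<in> ideal_gen B"
        using less.IH [of d' a'] Suc by (simp add: a'_def)
      then show ?thesis using g' b' by (simp add: ideal_gen_add ideal_gen_mult)
    qed
  qed
  show ?thesis
    proof (rule nonzerodivisor_modI)
    fix g assume g: "f * g \<in> ideal_gen B"
    \<comment> \<open>Both \<open>f\<close> and the ideal are homogeneous, so the components of
      \<open>g\<close> can be tested one by one.\<close>
    have "homogeneous_component d g \<in> ideal_gen B" for d
    proof (rule hom [OF homogeneous_homogeneous_component])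
      show "f * homogeneous_component d g \<in> ideal_gen B"
        using g assms(1) homogeneous_component_mult [OF assms(2), of d g]
        unfolding homogeneous_ideal_def by metis
    qed
    then show "g \<in> ideal_gen B"
      using sum_homogeneous_components [of g] ideal_gen_sum by metis
  qed
qed

text \<open>One half of permuting \<open>x, f\<close> into \<open>f, x\<close>: a relation
  \<open>x * g = b + h * f\<close> forces \<open>h\<close> to be a multiple of \<open>x\<close>
  modulo \<open>B\<close>, and then \<open>x\<close> cancels. For a variable \<open>x\<close>, the
  other half is \<open>nonzerodivisor_mod_lift_variable\<close>.\<close>

lemma nonzerodivisor_mod_exchange:
  assumes "nonzerodivisor_mod B x" "nonzerodivisor_mod (insert x B) f"
  shows "nonzerodivisor_mod (insert f B) x"
proof (rule nonzerodivisor_modI)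
  fix g assume "x * g \<in> ideal_gen (insert f B)"
  then obtain b h where b: "b \<in> ideal_gen B" "x * g = b + h * f"
    by (rule ideal_gen_insertE)
  have "f * h = x * g - b" using b(2) by (simp add: mult.commute)
  then have "f * h \<in> ideal_gen (insert x B)"
    by (simp add: b(1) ideal_gen_diff ideal_gen_base ideal_gen_mult_right ideal_gen_insertI)
  then have "h \<in> ideal_gen (insert x B)"
    by (rule nonzerodivisor_modD [OF assms(2)])
  then obtain a h' where a: "a \<in> ideal_gen B" "h = a + h' * x"
    by (rule ideal_gen_insertE)
  have "x * (g - h' * f) = x * g - h' * x * f" by (simp add: algebra_simps)
  also have "\<dots> = b + f * a" using b(2) a(2) by (simp add: algebra_simps)
  finally have "x * (g - h' * f) = b + f * a" .
  then have "x * (g - h' * f) \<in> ideal_gen B"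
    by (simp add: a(1) b(1) ideal_gen_add ideal_gen_mult)
  then show "g \<in> ideal_gen (insert f B)"
    unfolding ideal_gen_insert_iff using nonzerodivisor_modD [OF assms(1)] by blast
qed

text \<open>The variable is moved from the front of the sequence to its end, past one homogeneous
  element at a time; the ideal stays homogeneous on the way.\<close>

lemma regular_mod_lift_variable:
  fixes fs :: "('v::finite, 'k::field) polynomial_ring list"
  assumes "homogeneous_ideal B" "\<And>f. f \<in> set fs \<Longrightarrow> \<exists>e. homogeneous e f"
    and "nonzerodivisor_mod B (variable y)" "regular_mod (insert (variable y) B) fs"
  shows "regular_mod B fs \<and> nonzerodivisor_mod (B \<union> set fs) (variable y)"
  using assms
proof (induction fs arbitrary: B)
  case (Cons f fs)
  obtain e where e: "homogeneous e f" using Cons.prems(2) by auto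
  have f: "nonzerodivisor_mod (insert (variable y) B) f"
    using Cons.prems(4) by simp
  have "nonzerodivisor_mod B f"
    using nonzerodivisor_mod_lift_variable [OF Cons.prems(1) e Cons.prems(3) f] .
  moreover have "regular_mod (insert f B) fs
    \<and> nonzerodivisor_mod (insert f B \<union> set fs) (variable y)"
  proof (rule Cons.IH)
    show "homogeneous_ideal (insert f B)"
      using homogeneous_ideal_insert [OF Cons.prems(1) e] .
    show "nonzerodivisor_mod (insert f B) (variable y)"
      using nonzerodivisor_mod_exchange [OF Cons.prems(3) f] .
    show "regular_mod (insert (variable y) (insert f B)) fs"
      using Cons.prems(4) by (simp add: insert_commute)
  qed (use Cons.prems(2) in auto)
  ultimately show ?case by simp
qed simp


section \<open>Stanley-Reisner ideals\<close>

definition down_closed :: "'v set set \<Rightarrow> bool" where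
  "down_closed \<Delta> \<longleftrightarrow> (\<forall>F \<in> \<Delta>. \<forall>E. E \<subseteq> F \<longrightarrow> E \<in> \<Delta>)"

text \<open>Described by supports of monomials rather than by generators, so that colon ideals can
  be read off from exponents. That it is an ideal is derived from down-closedness.\<close>

definition stanley_reisner_ideal :: "'v set set \<Rightarrow> ('v, 'k::field) polynomial_ring set" where
  "stanley_reisner_ideal \<Delta> = {p. \<forall>t \<in> keys p. keys t \<notin> \<Delta>}"

lemma keys_add_nat: "keys (s + t :: 'v \<Rightarrow>\<^sub>0 nat) = keys s \<union> keys t"
  by (auto simp: in_keys_iff lookup_add)

lemma subspace_stanley_reisner_ideal:
  fixes \<Delta> :: "'v set set"
  assumes "down_closed \<Delta>"
  shows "module.subspace (*) (stanley_reisner_ideal \<Delta> :: ('v, 'k::field) polynomial_ring set)"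
proof (rule module.subspaceI [OF module_mult])
  fix p q :: "('v, 'k::field) polynomial_ring"
  assume "p \<in> stanley_reisner_ideal \<Delta>" "q \<in> stanley_reisner_ideal \<Delta>"
  then show "p + q \<in> stanley_reisner_ideal \<Delta>"
    using keys_add [of p q] by (auto simp: stanley_reisner_ideal_def)
next
  fix c p :: "('v, 'k::field) polynomial_ring"
  assume p: "p \<in> stanley_reisner_ideal \<Delta>"
  have "keys t \<notin> \<Delta>" if t: "t \<in> keys (c * p)" for t
  proof -
    obtain a b where "t = a + b" "b \<in> keys p" using t keys_mult [of c p] by auto
    then show ?thesis
      using p assms unfolding stanley_reisner_ideal_def down_closed_def
      by (metis (no_types, lifting) keys_add_nat mem_Collect_eq sup_ge2)
  qed
  then show "c * p \<in> stanley_reisner_ideal \<Delta>" by (simp add: stanley_reisner_ideal_def)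
qed (simp add: stanley_reisner_ideal_def)

lemma ideal_gen_stanley_reisner_ideal:
  "down_closed \<Delta> \<Longrightarrow> ideal_gen (stanley_reisner_ideal \<Delta>) = stanley_reisner_ideal \<Delta>"
  using module.span_eq_iff [OF module_mult] subspace_stanley_reisner_ideal
  unfolding ideal_gen_def by blast

lemma homogeneous_ideal_stanley_reisner_ideal:
  "down_closed \<Delta> \<Longrightarrow> homogeneous_ideal (stanley_reisner_ideal \<Delta>)"
  unfolding homogeneous_ideal_def ideal_gen_stanley_reisner_ideal
  by (auto simp: stanley_reisner_ideal_def keys_homogeneous_component)

lemma sum_monomials: "(\<Sum>t \<in> keys p. Poly_Mapping.single t (lookup p t)) = p"
  by (rule poly_mapping_eqI) (auto simp: lookup_sum lookup_single when_def in_keys_iff)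

lemma lookup_single_mult:
  fixes h :: "('v \<Rightarrow>\<^sub>0 nat) \<Rightarrow>\<^sub>0 'k::field"
  shows "lookup (Poly_Mapping.single s 1 * h) (s + t) = lookup h t"
proof -
  have "lookup (Poly_Mapping.single s 1 * h) (s + t)
      = (\<Sum>u \<in> keys h. lookup (Poly_Mapping.single (s + u) (lookup h u)) (s + t))"
    by (subst sum_monomials [of h, symmetric])
      (simp add: sum_distrib_left mult_single lookup_sum)
  also have "\<dots> = (\<Sum>u \<in> keys h. lookup (Poly_Mapping.single u (lookup h u)) t)"
    by (simp add: lookup_single)
  also have "\<dots> = lookup h t"
    by (metis lookup_sum sum_monomials)
  finally show ?thesis .
qed

lemma keys_single_mult:
  fixes h :: "('v \<Rightarrow>\<^sub>0 nat) \<Rightarrow>\<^sub>0 'k::field"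
  shows "keys (Poly_Mapping.single s 1 * h) = (+) s ` keys h"
proof
  show "keys (Poly_Mapping.single s 1 * h) \<subseteq> (+) s ` keys h"
    using keys_mult [of "Poly_Mapping.single s 1" h] by auto
  show "(+) s ` keys h \<subseteq> keys (Poly_Mapping.single s 1 * h)"
    by (auto simp: in_keys_iff lookup_single_mult)
qed

section \<open>Stars and deletions as operations on Stanley-Reisner ideals\<close>

definition face_star :: "'v \<Rightarrow> 'v set set \<Rightarrow> 'v set set" where
  "face_star w \<Delta> = {F. insert w F \<in> \<Delta>}"

definition face_deletion :: "'v \<Rightarrow> 'v set set \<Rightarrow> 'v set set" where
  "face_deletion w \<Delta> = {F \<in> \<Delta>. w \<notin> F}"

lemma down_closed_face_star: "down_closed \<Delta> \<Longrightarrow> down_closed (face_star w \<Delta>)"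
  unfolding down_closed_def face_star_def by (metis insert_mono mem_Collect_eq)

lemma down_closed_face_deletion: "down_closed \<Delta> \<Longrightarrow> down_closed (face_deletion w \<Delta>)"
  unfolding down_closed_def face_deletion_def by blast

text \<open>Multiplication by the variable adds \<open>w\<close> to the support of every monomial
  and cancels no term.\<close>

lemma stanley_reisner_ideal_colon:
  "variable w * h \<in> stanley_reisner_ideal \<Delta> \<longleftrightarrow> h \<in> stanley_reisner_ideal (face_star w \<Delta>)"
  by (simp add: stanley_reisner_ideal_def variable_def keys_single_mult keys_add_nat face_star_def)

text \<open>Divisibility by a squarefree monomial, applied with one variable for deletions and with
  two for the edges of the complementary graph.\<close>

lemma single_eq_mult_variables:
  fixes t :: "'v \<Rightarrow>\<^sub>0 nat" and c :: "'k::field"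
  assumes "finite F" "F \<subseteq> keys t"
  shows "\<exists>u. Poly_Mapping.single t c = Poly_Mapping.single u c * (\<Prod>v\<in>F. variable v)"
  using assms
proof (induction F)
  case empty
  then show ?case by auto
next
  case (insert w F)
  then obtain u where u: "Poly_Mapping.single t c = Poly_Mapping.single u c * (\<Prod>v\<in>F. variable v)"
    by auto
  have P: "(\<Prod>v\<in>F. variable v)
      = (Poly_Mapping.single (\<Sum>v\<in>F. Poly_Mapping.single v 1) 1 :: ('v, 'k) polynomial_ring)"
    using insert.hyps(1) by (induction F) (auto simp: variable_def mult_single)
  show ?case
  \<comment> \<open>Only a nonzero coefficient allows the exponents to be compared. As
    \<open>w\<close> is not in \<open>F\<close>, its exponent in \<open>t\<close> comes entirely
    from \<open>u\<close>.\<close>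
  proof (cases "c = 0")
    case False
    have "Poly_Mapping.single t c = Poly_Mapping.single (u + (\<Sum>v\<in>F. Poly_Mapping.single v 1)) c"
      using u by (simp add: P mult_single)
    then have t: "t = u + (\<Sum>v\<in>F. Poly_Mapping.single v 1)"
      using False by (metis keys_single singleton_inject)
    have "lookup (\<Sum>v\<in>F. Poly_Mapping.single v (1::nat)) w = 0"
      using insert.hyps by (auto simp: lookup_sum lookup_single when_def)
    then have "lookup u w \<noteq> 0"
      using insert.prems t by (auto simp: in_keys_iff lookup_add)
    then have "u = (u - Poly_Mapping.single w 1) + Poly_Mapping.single w 1"
      by (intro poly_mapping_eqI) (auto simp: lookup_add lookup_minus lookup_single when_def)
    then have "Poly_Mapping.single u c = Poly_Mapping.single (u - Poly_Mapping.single w 1) c * variable w"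
      by (simp add: variable_def mult_single)
    then show ?thesis
      using u insert.hyps by (auto simp: mult.assoc)
  qed auto
qed

text \<open>A monomial whose support is no face of the deletion either involves \<open>w\<close>,
  hence is a multiple of that variable, or has a nonface of \<Delta> as support.\<close>

lemma stanley_reisner_ideal_deletion:
  fixes w :: 'v
  assumes "down_closed \<Delta>"
  shows "ideal_gen (insert (variable w) (stanley_reisner_ideal \<Delta>))
    = (stanley_reisner_ideal (face_deletion w \<Delta>) :: ('v, 'k::field) polynomial_ring set)"
proof
  show "ideal_gen (insert (variable w) (stanley_reisner_ideal \<Delta>))
      \<subseteq> (stanley_reisner_ideal (face_deletion w \<Delta>) :: ('v, 'k) polynomial_ring set)"
    using subspace_stanley_reisner_ideal [OF down_closed_face_deletion [OF assms]]
    by (intro ideal_gen_minimal)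
      (auto simp: stanley_reisner_ideal_def variable_def face_deletion_def)
  show "stanley_reisner_ideal (face_deletion w \<Delta>)
      \<subseteq> (ideal_gen (insert (variable w) (stanley_reisner_ideal \<Delta>)) :: ('v, 'k) polynomial_ring set)"
  proof
    fix p :: "('v, 'k) polynomial_ring"
    assume p: "p \<in> stanley_reisner_ideal (face_deletion w \<Delta>)"
    have "Poly_Mapping.single t (lookup p t)
        \<in> ideal_gen (insert (variable w) (stanley_reisner_ideal \<Delta>))" if "t \<in> keys p" for t
    proof (cases "w \<in> keys t")
      case True
      then obtain u where "Poly_Mapping.single t (lookup p t)
          = Poly_Mapping.single u (lookup p t) * variable w"
        using single_eq_mult_variables [of "{w}" t "lookup p t"] by auto
      then show ?thesis by (simp add: ideal_gen_base ideal_gen_mult)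
    next
      case False
      then have "Poly_Mapping.single t (lookup p t) \<in> stanley_reisner_ideal \<Delta>"
        using p that by (auto simp: stanley_reisner_ideal_def face_deletion_def)
      then show ?thesis by (simp add: ideal_gen_base)
    qed
    then show "p \<in> ideal_gen (insert (variable w) (stanley_reisner_ideal \<Delta>))"
      by (subst sum_monomials [of p, symmetric]) (rule ideal_gen_sum)
  qed
qed


section \<open>Elementary symmetric polynomials as a regular sequence\<close>

text \<open>Taken in all variables of the type, so that one and the same sequence serves every
  complex.\<close>

definition elementary_symmetric :: "nat \<Rightarrow> ('v::finite, 'k::field) polynomial_ring" where
  "elementary_symmetric i = (\<Sum>F | card F = i. \<Prod>v\<in>F. variable v)"

lemma homogeneous_elementary_symmetric: "homogeneous i (elementary_symmetric i)"
  unfolding elementary_symmetric_def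
  by (rule homogeneous_sum) (use homogeneous_prod_variables in auto)

lemma down_closed_Pow [simp]: "down_closed (Pow Y)"
  by (auto simp: down_closed_def)

text \<open>Every other set of \<open>card Y\<close> vertices contains one outside \<open>Y\<close>,
  whose variable lies in the ideal.\<close>

lemma elementary_symmetric_mod_simplex:
  fixes Y :: "'v::finite set"
  shows "elementary_symmetric (card Y) - (\<Prod>v\<in>Y. variable v)
    \<in> ideal_gen (stanley_reisner_ideal (Pow Y) :: ('v, 'k::field) polynomial_ring set)"
proof -
  have "elementary_symmetric (card Y) - (\<Prod>v\<in>Y. variable v)
      = (\<Sum>F \<in> {F. card F = card Y} - {Y}. \<Prod>v\<in>F. variable v :: ('v, 'k) polynomial_ring)"
    by (simp add: elementary_symmetric_def sum_diff1)
  moreover have "(\<Prod>v\<in>F. variable v :: ('v, 'k) polynomial_ring)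
      \<in> ideal_gen (stanley_reisner_ideal (Pow Y))" if F: "card F = card Y" "F \<noteq> Y" for F
  proof -
    obtain v where v: "v \<in> F" "v \<notin> Y"
      using F card_subset_eq [of Y F] by auto
    have "variable v \<in> (stanley_reisner_ideal (Pow Y) :: ('v, 'k) polynomial_ring set)"
      using v by (simp add: stanley_reisner_ideal_def variable_def)
    then show ?thesis
      using v by (simp add: prod.remove [of F v] ideal_gen_base ideal_gen_mult_right)
  qed
  ultimately show ?thesis by (auto intro: ideal_gen_sum)
qed

text \<open>
  With \<open>m\<close> the number of variables, \<open>e\<^sub>1, \<dots>, e\<^bsub>m-1\<^esub>\<close> is regular after killing any one variable, hence
  every variable is a nonzerodivisor modulo \<open>e\<^sub>1, \<dots>, e\<^bsub>m-1\<^esub>\<close>, and so is their product \<open>e\<^sub>m\<close>.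
\<close>

lemma regular_mod_simplex_card:
  fixes Y :: "'v::finite set"
  shows "regular_mod (stanley_reisner_ideal (Pow Y) :: ('v, 'k::field) polynomial_ring set)
    (map elementary_symmetric [1..<Suc (card Y)])"
proof (induction "card Y" arbitrary: Y)
  case (Suc m)
  let ?I = "stanley_reisner_ideal (Pow Y) :: ('v, 'k) polynomial_ring set"
  let ?fs = "map elementary_symmetric [1..<Suc m] :: ('v, 'k) polynomial_ring list"
  have *: "regular_mod ?I ?fs \<and> nonzerodivisor_mod (?I \<union> set ?fs) (variable y)" if "y \<in> Y" for y
  proof (rule regular_mod_lift_variable)
    have star: "face_star y (Pow Y) = Pow Y" using that by (auto simp: face_star_def)
    show "nonzerodivisor_mod ?I (variable y)"
      by (rule nonzerodivisor_modI)
        (simp add: ideal_gen_stanley_reisner_ideal stanley_reisner_ideal_colon star)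
    have "face_deletion y (Pow Y) = Pow (Y - {y})" by (auto simp: face_deletion_def)
    then have "ideal_gen (insert (variable y) ?I) = ideal_gen (stanley_reisner_ideal (Pow (Y - {y})))"
      by (simp add: stanley_reisner_ideal_deletion ideal_gen_stanley_reisner_ideal)
    moreover have "m = card (Y - {y})" using Suc.hyps(2) that by simp
    ultimately show "regular_mod (insert (variable y) ?I) ?fs"
      using Suc.hyps(1) [of "Y - {y}"] regular_mod_cong by metis
  qed (use homogeneous_elementary_symmetric in \<open>auto intro: homogeneous_ideal_stanley_reisner_ideal\<close>)
  have "elementary_symmetric (Suc m) - (\<Prod>v\<in>Y. variable v) \<in> ideal_gen (?I \<union> set ?fs)"
    using elementary_symmetric_mod_simplex [of Y] ideal_gen_mono [of ?I "?I \<union> set ?fs"] Suc.hyps(2)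
    by auto
  then have "nonzerodivisor_mod (?I \<union> set ?fs) (elementary_symmetric (Suc m))"
    using nonzerodivisor_mod_congruent nonzerodivisor_mod_prod * by metis
  \<comment> \<open>Some \<open>y\<close> is needed to extract the regularity of \<open>?fs\<close>
    from \<open>*\<close>.\<close>
  moreover have "Y \<noteq> {}" using Suc.hyps(2) by auto
  ultimately have "regular_mod ?I (?fs @ [elementary_symmetric (Suc m)])"
    using * by auto
  then show ?case using Suc.hyps(2) by simp
qed simp

lemma regular_mod_simplex:
  fixes Y :: "'v::finite set"
  assumes "r \<le> card Y"
  shows "regular_mod (stanley_reisner_ideal (Pow Y) :: ('v, 'k::field) polynomial_ring set)
    (map elementary_symmetric [1..<Suc r])"
proof -
  have "[1..<Suc (card Y)] = [1..<Suc r] @ [Suc r..<Suc (card Y)]"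
    using assms by (metis One_nat_def Suc_le_mono le_add1 plus_1_eq_Suc upt_add_eq_append le_iff_add)
  then show ?thesis
    using regular_mod_simplex_card [of Y, where 'k = 'k] by simp
qed

section \<open>Filtrations of face rings\<close>

text \<open>
  \<open>face_filtration r \<Delta>\<close> amounts to a filtration of the face ring of \<open>\<Delta>\<close> whose factors are polynomial
  rings in at least \<open>r\<close> of the variables.
\<close>

inductive face_filtration :: "nat \<Rightarrow> 'v::finite set set \<Rightarrow> bool" where
  simplex: "r \<le> card Y \<Longrightarrow> face_filtration r (Pow Y)"
| vertex: "down_closed \<Delta> \<Longrightarrow> face_filtration r (face_star w \<Delta>) \<Longrightarrow>
    face_filtration r (face_deletion w \<Delta>) \<Longrightarrow> face_filtration r \<Delta>"

lemma face_filtration_mono: "face_filtration r \<Delta> \<Longrightarrow> s \<le> r \<Longrightarrow> face_filtration s \<Delta>"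
  by (induction rule: face_filtration.induct) (auto intro: face_filtration.intros)

text \<open>The sequence does not depend on the complex, so regularity on star and deletion can be
  combined by \<open>regular_mod_colon\<close>.\<close>

lemma regular_mod_face_filtration:
  assumes "face_filtration r (\<Delta> :: 'v::finite set set)"
  shows "regular_mod (stanley_reisner_ideal \<Delta> :: ('v, 'k::field) polynomial_ring set)
    (map elementary_symmetric [1..<Suc r])"
  using assms
proof induction
  case (simplex r Y)
  then show ?case by (rule regular_mod_simplex)
next
  case (vertex \<Delta> r w)
  show ?case
  proof (rule regular_mod_colon)
    show "variable w * h \<in> ideal_gen (stanley_reisner_ideal \<Delta>) \<longleftrightarrow>
        h \<in> ideal_gen (stanley_reisner_ideal (face_star w \<Delta>))" for h :: "('v, 'k) polynomial_ring"
      using vertex.hyps(1)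
      by (simp add: stanley_reisner_ideal_colon ideal_gen_stanley_reisner_ideal down_closed_face_star)
    have "ideal_gen (insert (variable w) (stanley_reisner_ideal \<Delta>))
        = ideal_gen (stanley_reisner_ideal (face_deletion w \<Delta>) :: ('v, 'k) polynomial_ring set)"
      using vertex.hyps(1)
      by (simp add: stanley_reisner_ideal_deletion ideal_gen_stanley_reisner_ideal
          down_closed_face_deletion)
    then show "regular_mod (insert (variable w) (stanley_reisner_ideal \<Delta>)
        :: ('v, 'k) polynomial_ring set) (map elementary_symmetric [1..<Suc r])"
      using vertex.IH(2) regular_mod_cong by metis
  qed (rule vertex.IH(1))
qed


section \<open>Clique complexes\<close>

text \<open>A finite simple graph on the whole vertex type, given by neighbourhoods; induced
  subgraphs are then plain vertex sets.\<close>

locale loopless_symmetric =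
  fixes N :: "'v::finite \<Rightarrow> 'v set"
  assumes symmetric: "v \<in> N u \<Longrightarrow> u \<in> N v"
    and loopless: "v \<notin> N v"
begin

text \<open>\<open>Y\<close> collects the cone points: vertices whose star has been taken, so that their variables are free.\<close>

definition clique_join :: "'v set \<Rightarrow> 'v set \<Rightarrow> 'v set set" where
  "clique_join U Y =
    {F. F \<subseteq> U \<union> Y \<and> (\<forall>u \<in> F \<inter> U. \<forall>v \<in> F \<inter> U. u \<noteq> v \<longrightarrow> v \<in> N u)}"

text \<open>A depth bound \<open>r\<close> for the clique complex of the subgraph induced on
  \<open>U\<close>. It is stated for all sets \<open>Y\<close> of cone points because stars create
  new ones, each worth one further variable.\<close>

definition filtered :: "nat \<Rightarrow> 'v set \<Rightarrow> bool" where
  "filtered r U \<longleftrightarrow> (\<forall>Y. U \<inter> Y = {} \<longrightarrow> face_filtration (r + card Y) (clique_join U Y))"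

lemma down_closed_clique_join: "down_closed (clique_join U Y)"
  unfolding down_closed_def clique_join_def by blast

text \<open>In a clique containing \<open>w\<close> all other vertices from \<open>U\<close> are
  neighbours of \<open>w\<close>; once \<open>U\<close> is cut down to these, \<open>w\<close>
  imposes no condition and joins the cone points.\<close>

lemma face_star_clique_join:
  assumes "w \<in> U" "U \<inter> Y = {}"
  shows "face_star w (clique_join U Y) = clique_join (U \<inter> N w) (insert w Y)"
proof (intro set_eqI iffI)
  fix F assume F: "F \<in> face_star w (clique_join U Y)"
  have "F \<subseteq> (U \<inter> N w) \<union> insert w Y"
  proof
    fix v assume "v \<in> F"
    then show "v \<in> (U \<inter> N w) \<union> insert w Y"
      using F assms by (cases "v = w") (auto simp: face_star_def clique_join_def)
  qed
  then show "F \<in> clique_join (U \<inter> N w) (insert w Y)"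
    using F by (auto simp: face_star_def clique_join_def)
next
  fix F assume F: "F \<in> clique_join (U \<inter> N w) (insert w Y)"
  have "v \<in> N u" if "u \<in> insert w F \<inter> U" "v \<in> insert w F \<inter> U" "u \<noteq> v" for u v
  proof -
    have *: "x = w \<or> x \<in> U \<inter> N w" if "x \<in> insert w F \<inter> U" for x
      using that F assms by (auto simp: clique_join_def)
    consider "u = w" | "v = w" | "u \<noteq> w" "v \<noteq> w" by blast
    then show ?thesis
    proof cases
      case 1
      then show ?thesis using * [OF that(2)] that(3) by auto
    next
      case 2
      then show ?thesis using * [OF that(1)] that(3) symmetric [of u w] by auto
    next
      case 3
      then show ?thesis
        using * [OF that(1)] * [OF that(2)] that F by (auto simp: clique_join_def)
    qed
  qed
  then show "F \<in> face_star w (clique_join U Y)"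
    using F assms by (auto simp: face_star_def clique_join_def)
qed

lemma face_deletion_clique_join:
  assumes "w \<in> U" "U \<inter> Y = {}"
  shows "face_deletion w (clique_join U Y) = clique_join (U - {w}) Y"
  using assms by (auto simp: face_deletion_def clique_join_def)

lemma clique_join_cone:
  assumes "y \<in> U" "U - {y} \<subseteq> N y" "U \<inter> Y = {}"
  shows "clique_join U Y = clique_join (U - {y}) (insert y Y)"
proof (intro set_eqI iffI)
  fix F assume F: "F \<in> clique_join (U - {y}) (insert y Y)"
  have "v \<in> N u" if "u \<in> F \<inter> U" "v \<in> F \<inter> U" "u \<noteq> v" for u v
  proof (cases "u = y \<or> v = y")
    case True
    then show ?thesis using that assms(2) symmetric by blast
  next
    case False
    then show ?thesis using that F by (auto simp: clique_join_def)
  qed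
  then show "F \<in> clique_join U Y" using F assms by (auto simp: clique_join_def)
qed (use assms in \<open>auto simp: clique_join_def\<close>)

section \<open>Filtrations from the vertex set alone\<close>

lemma filtered_empty: "filtered 0 {}"
  unfolding filtered_def
proof (intro allI impI)
  fix Y :: "'v set"
  have "clique_join {} Y = Pow Y" by (auto simp: clique_join_def)
  then show "face_filtration (0 + card Y) (clique_join {} Y)"
    by (simp add: face_filtration.simplex)
qed

text \<open>In the star, \<open>w\<close> is a new cone point and supplies the variable missing from
  the bound for \<open>U \<inter> N w\<close>.\<close>

lemma filtered_vertex:
  assumes "w \<in> U" "filtered r (U \<inter> N w)" "filtered (Suc r) (U - {w})"
  shows "filtered (Suc r) U"
  unfolding filtered_def
proof (intro allI impI)
  fix Y assume Y: "U \<inter> Y = {}"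
  have "U \<inter> N w \<inter> insert w Y = {}" "w \<notin> Y" using Y assms(1) loopless by auto
  then have "face_filtration (Suc r + card Y) (face_star w (clique_join U Y))"
    using assms(2) Y unfolding filtered_def face_star_clique_join [OF assms(1) Y]
    by (metis add_Suc add_Suc_right card_insert_disjoint finite)
  moreover have "face_filtration (Suc r + card Y) (face_deletion w (clique_join U Y))"
    using assms(3) Y unfolding filtered_def face_deletion_clique_join [OF assms(1) Y] by blast
  ultimately show "face_filtration (Suc r + card Y) (clique_join U Y)"
    using down_closed_clique_join face_filtration.vertex by blast
qed

lemma filtered_cone:
  assumes "y \<in> U" "U - {y} \<subseteq> N y" "filtered r (U - {y})"
  shows "filtered (Suc r) U"
  unfolding filtered_def
proof (intro allI impI)
  fix Y assume Y: "U \<inter> Y = {}"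
  have "(U - {y}) \<inter> insert y Y = {}" "y \<notin> Y" using Y assms(1) by auto
  then show "face_filtration (Suc r + card Y) (clique_join U Y)"
    using assms(3) unfolding filtered_def clique_join_cone [OF assms(1,2) Y]
    by (metis add_Suc add_Suc_right card_insert_disjoint finite)
qed

lemma filtered_0: "filtered 0 U"
proof (induction "card U" arbitrary: U rule: less_induct)
  case less
  show ?case
  proof (cases "U = {}")
    case False
    then obtain w where w: "w \<in> U" by auto
    show ?thesis unfolding filtered_def
    proof (intro allI impI)
      fix Y assume Y: "U \<inter> Y = {}"
      have disj: "U \<inter> N w \<inter> insert w Y = {}" "w \<notin> Y" using Y w loopless by auto
      have "U \<inter> N w \<subset> U" "U - {w} \<subset> U" using w loopless by auto
      then have sub: "filtered 0 (U \<inter> N w)" "filtered 0 (U - {w})"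
        using less psubset_card_mono [of U] by auto
      then have "face_filtration (card (insert w Y)) (clique_join (U \<inter> N w) (insert w Y))"
        using sub(1) [unfolded filtered_def, rule_format, OF disj(1)] by simp
      \<comment> \<open>The cone point \<open>w\<close> gives one variable more than required;
        monotonicity drops the surplus.\<close>
      then have "face_filtration (card Y) (face_star w (clique_join U Y))"
        using face_filtration_mono face_star_clique_join [OF w Y]
        by (metis card_insert_le)
      moreover have "face_filtration (card Y) (face_deletion w (clique_join U Y))"
        using sub(2) Y unfolding filtered_def face_deletion_clique_join [OF w Y] by auto
      ultimately show "face_filtration (0 + card Y) (clique_join U Y)"
        using down_closed_clique_join face_filtration.vertex by fastforce
    qed
  qed (simp add: filtered_empty)
qed

text \<open>Vertices are deleted until a single one is left, which is a cone point; each star on the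
  way has a cone point of its own.\<close>

lemma filtered_1: "U \<noteq> {} \<Longrightarrow> filtered (Suc 0) U"
proof (induction "card U" arbitrary: U rule: less_induct)
  case less
  then obtain w where w: "w \<in> U" by auto
  show ?case
  proof (cases "U = {w}")
    case True
    then show ?thesis using filtered_cone [of w U 0] filtered_0 by auto
  next
    case False
    have "card (U - {w}) < card U" using w by (intro psubset_card_mono) auto
    moreover have "U - {w} \<noteq> {}" using False w by blast
    ultimately have "filtered (Suc 0) (U - {w})" by (rule less.hyps)
    then show ?thesis using filtered_vertex w filtered_0 by blast
  qed
qed

text \<open>Empty sets and singletons count as connected, hence the separate bound on
  \<open>card U\<close> in \<open>filtered_2\<close>.\<close>

definition connected_set :: "'v set \<Rightarrow> bool" where
  "connected_set U \<longleftrightarrow> (\<forall>A. A \<noteq> {} \<longrightarrow> A \<subset> U \<longrightarrow> (\<exists>a \<in> A. \<exists>b \<in> U - A. b \<in> N a))"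

text \<open>\<open>A\<close> grows by a vertex \<open>b\<close> with a neighbour in
  \<open>A\<close>: deleting \<open>b\<close> gives back \<open>A\<close>, and the star of
  \<open>b\<close> lives over a nonempty set, where \<open>filtered_1\<close> applies.\<close>

lemma filtered_2_extend:
  assumes "connected_set U" "A \<noteq> {}" "A \<subseteq> U" "filtered 2 A"
  shows "filtered 2 U"
  using assms(2-4)
proof (induction "card (U - A)" arbitrary: A rule: less_induct)
  case less
  show ?case
  proof (cases "A = U")
    case False
    then obtain a b where ab: "a \<in> A" "b \<in> U - A" "b \<in> N a"
      using assms(1) less.prems unfolding connected_set_def by blast
    have "a \<in> insert b A \<inter> N b" using ab symmetric by auto
    then have "filtered (Suc 0) (insert b A \<inter> N b)" by (intro filtered_1) auto
    moreover have "insert b A - {b} = A" using ab by auto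
    ultimately have "filtered 2 (insert b A)"
      using filtered_vertex [of b "insert b A" "Suc 0"] less.prems(3) by (simp add: numeral_2_eq_2)
    moreover have "card (U - insert b A) < card (U - A)"
      using ab by (intro psubset_card_mono) auto
    moreover have "insert b A \<subseteq> U" using ab less.prems(2) by auto
    ultimately show ?thesis by (intro less.hyps [of "insert b A"]) auto
  qed (use less.prems in simp)
qed

text \<open>The growth starts from an edge, which is a simplex with two vertices.\<close>

lemma filtered_2:
  assumes "connected_set U" "card U \<ge> 2"
  shows "filtered 2 U"
proof -
  obtain a where a: "a \<in> U" using assms(2) by fastforce
  moreover have "U \<noteq> {a}" using assms(2) by auto
  ultimately obtain b where b: "b \<in> U" "b \<in> N a"
    using assms(1) unfolding connected_set_def
    by (metis empty_not_insert insert_subset psubsetI bot.extremum singletonD DiffD1)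
  have "b \<noteq> a" using b loopless by auto
  then have "filtered (Suc (Suc 0)) {a, b}"
    using b filtered_1 [of "{b}"] filtered_cone [of a "{a, b}" "Suc 0"] by (simp add: insert_Diff_if)
  then show ?thesis
    using filtered_2_extend [OF assms(1), of "{a, b}"] a b by (simp add: numeral_2_eq_2)
qed

section \<open>Depth gained from higher connectivity\<close>

definition non_neighbours :: "'v \<Rightarrow> 'v set" where
  "non_neighbours v = - insert v (N v)"

text \<open>
  Deleting the non-neighbours \<open>x\<^sub>1, x\<^sub>2, \<dots>\<close> of a fixed vertex \<open>y\<close> one after another turns \<open>y\<close> into a cone
  point, which gains one variable. Passing to the star of \<open>x\<^sub>j\<close> on the way also gains one variable, and
  only the at most \<open>(d - 1) + (d + 1)\<close> vertices \<open>x\<^sub>1, \<dots>, x\<^sub>j\<close> and non-neighbours of \<open>x\<^sub>j\<close> are lost.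
\<close>

lemma filtered_of_connectivity:
  assumes deg: "\<And>v. card (non_neighbours v) \<le> d" and "d \<ge> 1"
    and conn: "\<And>U. card (- U) < k \<Longrightarrow> connected_set U \<and> card U \<ge> 2"
    and "card (- U) + 2 * d * t < k"
  shows "filtered (t + 2) U"
  using assms(4)
proof (induction t arbitrary: U)
  case 0
  then show ?case using conn [of U] filtered_2 [of U] by (simp add: numeral_2_eq_2)
next
  case (Suc t)
  have IH: "filtered (t + 2) W" if "card (- W) \<le> card (- U) + 2 * d" for W
    using Suc.IH [of W] Suc.prems that by simp
  have "card U \<ge> 2" using conn Suc.prems by simp
  then obtain y where y: "y \<in> U" by fastforce
  define D where "D = U \<inter> non_neighbours y"
  have card_D: "card D \<le> d"
    using deg [of y] card_mono [of "non_neighbours y" D] by (auto simp: D_def)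
  \<comment> \<open>Here \<open>D'\<close> holds the non-neighbours of \<open>y\<close> deleted so
    far. The induction starts from \<open>D' = D\<close>, where \<open>y\<close> is a cone point,
    and ends at \<open>D' = {}\<close>.\<close>
  have "filtered (Suc t + 2) (U - D')" if "D' \<subseteq> D" for D'
    using that
  proof (induction "card (D - D')" arbitrary: D' rule: less_induct)
    case less
    show ?case
    proof (cases "D' = D")
      case True
      have y': "y \<in> U - D'" "U - D' - {y} \<subseteq> N y"
        using y loopless True by (auto simp: D_def non_neighbours_def)
      have "- (U - D' - {y}) = - U \<union> D' \<union> {y}" using y by auto
      then have "card (- (U - D' - {y})) \<le> card (- U) + card D' + 1"
        using card_Un_le [of "- U \<union> D'" "{y}"] card_Un_le [of "- U" D'] by simp
      \<comment> \<open>At most \<open>d + 1\<close> vertices are lost, and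
        \<open>d + 1 \<le> 2 * d\<close> because \<open>d \<ge> 1\<close>.\<close>
      then have "filtered (t + 2) (U - D' - {y})"
        using card_D True \<open>d \<ge> 1\<close> by (intro IH) simp
      then show ?thesis using filtered_cone [OF y'] by simp
    next
      case False
      then obtain x where x: "x \<in> D" "x \<notin> D'" using less.prems by auto
      have "D' \<subset> D" using False less.prems by auto
      then have "card D' < d" using card_D psubset_card_mono [of D D'] by simp
      moreover have "- ((U - D') \<inter> N x) \<subseteq> - U \<union> D' \<union> insert x (non_neighbours x)"
        by (auto simp: non_neighbours_def)
      then have "card (- ((U - D') \<inter> N x)) \<le> card (- U \<union> D' \<union> insert x (non_neighbours x))"
        by (intro card_mono) auto
      moreover have "card (insert x (non_neighbours x)) \<le> Suc d"
        using deg [of x] card_insert_le_m1 [of "Suc d" "non_neighbours x" x] by simp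
      ultimately have "filtered (t + 2) ((U - D') \<inter> N x)"
        using card_Un_le [of "- U \<union> D'" "insert x (non_neighbours x)"] card_Un_le [of "- U" D']
        by (intro IH) simp
      moreover have "filtered (Suc (t + 2)) (U - D' - {x})"
      proof -
        have "D - insert x D' \<subset> D - D'" using x by blast
        then have "card (D - insert x D') < card (D - D')" by (intro psubset_card_mono) simp_all
        moreover have "insert x D' \<subseteq> D" using x less.prems by simp
        ultimately have "filtered (Suc t + 2) (U - insert x D')" by (rule less.hyps)
        then show ?thesis by (simp only: Diff_insert [of U x D'] add_Suc)
      qed
      moreover have "x \<in> U - D'" using x by (simp add: D_def)
      ultimately have "filtered (Suc (t + 2)) (U - D')" by (intro filtered_vertex [of x "U - D'"])
      then show ?thesis by simp
    qed
  qed
  from this [of "{}"] show ?case by simp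
qed

end


section \<open>The edge ideal of the complementary graph\<close>

text \<open>A walk from inside \<open>A\<close> to outside would have to leave \<open>A\<close>
  along some arc; symmetry of \<open>G\<close> covers the arcs that the symmetric closure
  reverses.\<close>

lemma connected_induced_crossing:
  fixes G :: "'v pair_pre_digraph"
  assumes conn: "Digraph_Component.connected (with_proj G \<restriction> U)"
    and sym: "\<And>u v. (u, v) \<in> parcs G \<Longrightarrow> (v, u) \<in> parcs G"
    and A: "A \<noteq> {}" "A \<subset> U"
  shows "\<exists>a \<in> A. \<exists>b \<in> U - A. (a, b) \<in> parcs G"
proof (rule ccontr)
  assume no: "\<not> ?thesis"
  obtain a b where ab: "a \<in> A" "b \<in> U - A" using A by auto
  then have "(a, b) \<in> rtrancl_on U (parcs (mk_symmetric (with_proj G \<restriction> U)))"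
    using conn A unfolding connected_def strongly_connected_def reachable_def by auto
  then have "b \<in> A"
    using ab(1)
  proof (induction rule: rtrancl_on_induct)
    case (step u v)
    then show ?case using no sym by (auto simp: parcs_mk_symmetric)
  qed
  then show False using ab by simp
qed

text \<open>A nonface contains two vertices not adjacent in \<open>G\<close>, so a monomial
  supported on it is divisible by a generator of the edge ideal.\<close>

lemma edge_ideal_complement_graph:
  fixes G :: "'v::finite pair_pre_digraph"
  assumes "pverts G = UNIV"
  shows "edge_ideal (complement_graph G)
    = (stanley_reisner_ideal {F. \<forall>u \<in> F. \<forall>v \<in> F. u \<noteq> v \<longrightarrow> (u, v) \<in> parcs G}
        :: ('v, 'k::field) polynomial_ring set)"
    (is "?L = stanley_reisner_ideal ?\<Delta>")
proof
  have "down_closed ?\<Delta>" by (auto simp: down_closed_def)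
  then show "?L \<subseteq> stanley_reisner_ideal ?\<Delta>"
    unfolding edge_ideal_def
    by (intro ideal_gen_minimal subspace_stanley_reisner_ideal)
      (auto simp: stanley_reisner_ideal_def variable_def mult_single keys_add_nat
        complement_graph_def)
  show "stanley_reisner_ideal ?\<Delta> \<subseteq> ?L"
  proof
    fix p :: "('v, 'k) polynomial_ring"
    assume p: "p \<in> stanley_reisner_ideal ?\<Delta>"
    have "Poly_Mapping.single t (lookup p t) \<in> ?L" if t: "t \<in> keys p" for t
    proof -
      obtain u v where uv: "u \<in> keys t" "v \<in> keys t" "u \<noteq> v" "(u, v) \<notin> parcs G"
        using p t by (auto simp: stanley_reisner_ideal_def)
      then obtain s where "Poly_Mapping.single t (lookup p t)
          = Poly_Mapping.single s (lookup p t) * (variable u * variable v)"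
        using single_eq_mult_variables [of "{u, v}" t "lookup p t"] by auto
      moreover have "variable u * variable v \<in> ?L"
        unfolding edge_ideal_def
        using uv assms by (intro ideal_gen_base) (auto simp: complement_graph_def)
      ultimately show ?thesis by (simp add: edge_ideal_def ideal_gen_mult)
    qed
    then show "p \<in> ?L"
      unfolding edge_ideal_def
      by (subst sum_monomials [of p, symmetric]) (rule ideal_gen_sum)
  qed
qed

section \<open>From filtrations to depth\<close>

lemma elementary_symmetric_in_graded_maximal_ideal:
  assumes "i > 0"
  shows "elementary_symmetric i \<in> (graded_maximal_ideal :: ('v::finite, 'k::field) polynomial_ring set)"
proof -
  have "(\<Prod>v\<in>F. variable v) \<in> (graded_maximal_ideal :: ('v, 'k) polynomial_ring set)"
    if F: "card F = i" for F
  proof -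
    obtain v where v: "v \<in> F" using F assms by fastforce
    then show ?thesis
      unfolding graded_maximal_ideal_def
      by (simp add: prod.remove [of F v] ideal_gen_base ideal_gen_mult_right)
  qed
  then show ?thesis
    unfolding elementary_symmetric_def graded_maximal_ideal_def by (auto intro: ideal_gen_sum)
qed

text \<open>The ideal of the complex \<open>{{}}\<close> consists of the polynomials without
  constant term; it bounds the ideals whose properness is needed.\<close>

lemma graded_maximal_ideal_subset:
  "graded_maximal_ideal \<subseteq> (stanley_reisner_ideal {{}} :: ('v, 'k::field) polynomial_ring set)"
  unfolding graded_maximal_ideal_def
  by (intro ideal_gen_minimal subspace_stanley_reisner_ideal)
    (auto simp: stanley_reisner_ideal_def variable_def down_closed_def simp del: keys_eq_empty)

lemma depth_quotient_ge:
  fixes \<Delta> :: "'v::finite set set"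
  assumes "face_filtration r \<Delta>" "down_closed \<Delta>" "{} \<in> \<Delta>"
  shows "enat r \<le> depth_quotient graded_maximal_ideal
    (stanley_reisner_ideal \<Delta> :: ('v, 'k::field) polynomial_ring set)"
proof -
  let ?I = "stanley_reisner_ideal \<Delta> :: ('v, 'k) polynomial_ring set"
  let ?fs = "map elementary_symmetric [1..<Suc r] :: ('v, 'k) polynomial_ring list"
  have fs: "set ?fs \<subseteq> graded_maximal_ideal"
    by (auto intro!: elementary_symmetric_in_graded_maximal_ideal)
  have "?I \<subseteq> stanley_reisner_ideal {{}}"
    using assms(3) by (auto simp: stanley_reisner_ideal_def)
  then have "?I \<union> set ?fs \<subseteq> stanley_reisner_ideal {{}}"
    using fs graded_maximal_ideal_subset by blast
  then have "ideal_gen (?I \<union> set ?fs) \<subseteq> stanley_reisner_ideal {{}}"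
    by (intro ideal_gen_minimal subspace_stanley_reisner_ideal) (auto simp: down_closed_def)
  moreover have "1 \<notin> (stanley_reisner_ideal {{}} :: ('v, 'k) polynomial_ring set)"
    by (simp add: stanley_reisner_ideal_def)
  ultimately have "ideal_gen (?I \<union> set ?fs) \<noteq> UNIV" by blast
  then have "regular_on_quotient ?I ?fs"
    using regular_mod_face_filtration [OF assms(1)] unfolding regular_on_quotient_iff by blast
  then have "enat (length ?fs) \<le> depth_quotient graded_maximal_ideal ?I"
    unfolding depth_quotient_def using fs by (intro SUP_upper) simp
  then show ?thesis by (simp del: upt_Suc)
qed

theorem theorem2p1:
  fixes G :: "'v::finite pair_pre_digraph" and n k :: nat
  assumes "pair_graph G"
    and "pverts G = UNIV"
    and "n = card (pverts G)"
    and "\<not> complete_digraph n (with_proj G)"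
    and "k = vertex_connectivity G"
  shows "depth_quotient graded_maximal_ideal
           (edge_ideal (complement_graph G) :: ('v, 'k::field) polynomial_ring set)
         \<ge> enat (nat (\<lceil>real k / (2 * (real n - real k - 1))\<rceil> + 1))"
proof -
  interpret pair_graph G by fact
  define N where "N u = {v. (u, v) \<in> parcs G}" for u
  have sym: "(v, u) \<in> parcs G" if "(u, v) \<in> parcs G" for u v
    using that sym_arcs by (auto simp: symmetric_def elim: symE)
  have loop: "(v, v) \<notin> parcs G" for v using pair_no_loops [of "(v, v)"] by auto
  interpret N: loopless_symmetric N
    using sym loop by unfold_locales (auto simp: N_def)
  let ?disconnected = "\<lambda>W. \<not> Digraph_Component.connected (with_proj G \<restriction> (UNIV - W))"
  have k_le: "k \<le> card W" if "?disconnected W" for W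
    unfolding assms(5) vertex_connectivity_def assms(2) using that by (intro Least_le) auto
  \<comment> \<open>\<open>?disconnected\<close> names the removed vertices, so \<open>- U\<close>
    refers to the subgraph induced on \<open>U\<close>.\<close>
  have disconnectedI: "?disconnected (- U)"
    if "A \<noteq> {}" "A \<subset> U" "\<And>a b. a \<in> A \<Longrightarrow> b \<in> U - A \<Longrightarrow> b \<notin> N a" for A U
    using connected_induced_crossing [of G U A] sym that by (auto simp: N_def Diff_eq)
  have card_Compl: "card (- W) = n - card W" for W :: "'v set"
    by (simp add: card_Diff_subset Compl_eq_Diff_UNIV assms(2,3))
  obtain u v where uv: "u \<noteq> v" "v \<notin> N u"
    using assms(2,3,4) loop unfolding complete_digraph_pair_def N_def by auto
  have "k + 2 \<le> n"
  proof -
    \<comment> \<open>Two non-adjacent vertices remain, so \<open>k\<close> is at most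
      \<open>n - 2\<close>.\<close>
    have "?disconnected (- {u, v})" using uv by (intro disconnectedI [of "{u}"]) auto
    then have "k \<le> n - 2" using k_le [of "- {u, v}"] uv by (simp add: card_Compl)
    moreover have "2 \<le> n" using uv card_mono [of UNIV "{u, v}"] assms(2,3) by simp
    ultimately show ?thesis by simp
  qed
  define d where "d = n - k - 1"
  have d: "d \<ge> 1" "real d = real n - real k - 1" using \<open>k + 2 \<le> n\<close> by (auto simp: d_def)
  \<comment> \<open>Removing the neighbours of a vertex \<open>x\<close> that has non-neighbours
    isolates \<open>x\<close>. Hence \<open>x\<close> has at least \<open>k\<close> neighbours,
    which leaves at most \<open>n - 1 - k\<close> non-neighbours.\<close>
  have deg: "card (N.non_neighbours x) \<le> d" for x
  proof (cases "N.non_neighbours x = {}")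
    case False
    have "?disconnected (- (- N x))"
      using False N.loopless
      by (intro disconnectedI [of "{x}"]) (auto simp: N.non_neighbours_def)
    then have "k \<le> card (N x)" using k_le [of "N x"] by simp
    moreover have "card (insert x (N x)) = Suc (card (N x))" using N.loopless by simp
    ultimately show ?thesis by (simp add: N.non_neighbours_def card_Compl d_def)
  qed simp
  have conn: "N.connected_set U \<and> card U \<ge> 2" if "card (- U) < k" for U
  proof
    show "N.connected_set U"
      unfolding N.connected_set_def
    proof (intro allI impI, rule ccontr)
      fix A assume "A \<noteq> {}" "A \<subset> U" "\<not> (\<exists>a \<in> A. \<exists>b \<in> U - A. b \<in> N a)"
      then have "?disconnected (- U)" by (intro disconnectedI [of A]) blast+
      then show False using k_le [of "- U"] that by simp
    qed
    show "card U \<ge> 2"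
      using that \<open>k + 2 \<le> n\<close> card_Compl [of U] by simp
  qed
  define r where "r = nat (\<lceil>real k / (2 * real d)\<rceil> + 1)"
  have "N.filtered r UNIV"
  proof (cases "k = 0")
    case True
    then show ?thesis using N.filtered_1 [of UNIV] by (simp add: r_def)
  next
    case False
    \<comment> \<open>The largest integer strictly below \<open>k / (2 * d)\<close>, as the strict
      bound in \<open>filtered_of_connectivity\<close> demands; then \<open>t + 2\<close> is the
      ceiling plus one. For \<open>k = 0\<close> it would be negative, hence the case split.\<close>
    define t where "t = nat (\<lceil>real k / (2 * real d)\<rceil> - 1)"
    have "real k / (2 * real d) > 0" using False d(1) by simp
    then have c: "\<lceil>real k / (2 * real d)\<rceil> \<ge> 1" by linarith
    have "real t < real k / (2 * real d)"
      using c unfolding t_def by linarith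
    then have "real (2 * d * t) < real k" using d(1) by (simp add: field_simps)
    then have "2 * d * t < k" by (rule of_nat_less_imp_less)
    then have "N.filtered (t + 2) UNIV"
      using N.filtered_of_connectivity [OF deg d(1) conn, where U = UNIV and t = t] by simp
    moreover have "r = t + 2" unfolding r_def t_def using c by arith
    ultimately show ?thesis by simp
  qed
  then have "face_filtration r (N.clique_join UNIV {})"
    unfolding N.filtered_def by force
  moreover have "N.clique_join UNIV {} = {F. \<forall>u \<in> F. \<forall>v \<in> F. u \<noteq> v \<longrightarrow> (u, v) \<in> parcs G}"
    by (auto simp: N.clique_join_def N_def)
  ultimately have "enat r \<le> depth_quotient graded_maximal_ideal
      (edge_ideal (complement_graph G) :: ('v, 'k) polynomial_ring set)"
    unfolding edge_ideal_complement_graph [OF assms(2)]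
    using N.down_closed_clique_join [of UNIV "{}"] by (intro depth_quotient_ge) auto
  then show ?thesis by (simp add: r_def d(2))
qed

end
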